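(* Let $G$ and $H$ be connected graphs. Then $$\max\{\omega(G),\omega(H)\}\le \mathrm{mp}(G\,\square\,H)\le \max\{\omega(G),\ \omega(H),\ \sigma(G)\,\mathrm{mp}_i(H),\ \sigma(H)\,\mathrm{mp}_i(G)\}.$$ Furthermore, if neither $G$ nor $H$ has simplicial vertices, then $\mathrm{mp}(G\,\square\,H)=\max\{\omega(G),\omega(H)\}$.
   Context: All graphs are finite, simple and undirected. A path in a graph is monophonic (induced) if there are no edges between non-consecutive vertices of the path. A set $M$ of vertices of a graph is a monophonic position set if no three distinct vertices of $M$ lie on a common monophonic path; $\mathrm{mp}(G)$ is the largest cardinality of a monophonic position set of $G$, and $\mathrm{mp}_i(G)$ is the largest cardinality of a set of vertices of $G$ that is both an independent set and a monophonic position set. $\omega(G)$ is the clique number. A vertex is simplicial if its neighbourhood induces a clique; $\sigma(G)=1$ if $G$ contains at least one simplicial vertex and $\sigma(G)=0$ otherwise. The Cartesian product $G\,\square\,H$ has vertex set $V(G)\times V(H)$, with $(g_1,h_1)$ and $(g_2,h_2)$ adjacent iff ($g_1\sim g_2$ in $G$ and $h_1=h_2$) or ($g_1=g_2$ and $h_1\sim h_2$ in $H$).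
   Formalization: The upper bound is stated only when G and H each have at least two vertices; it fails for G = K1 and H two triangles sharing a vertex, where mp = 4 but the right-hand side is 3. *)

theory Defs
  imports "Graph_Theory.Graph_Theory"
begin

text \<open>A finite simple undirected graph is a value of type \<^typ>\<open>'a pair_pre_digraph\<close> satisfying
  \<^const>\<open>pair_graph\<close>: its set of arcs is a symmetric irreflexive relation on a finite vertex set, so
  \<open>u\<close> and \<open>v\<close> are adjacent iff \<open>(u, v) \<in> parcs G\<close>. The library notion \<^const>\<open>connected\<close> excludes
  the graph without vertices.\<close>

definition is_clique :: "'a pair_pre_digraph \<Rightarrow> 'a set \<Rightarrow> bool" where
  "is_clique G S \<longleftrightarrow> S \<subseteq> pverts G \<and> (\<forall>u\<in>S. \<forall>v\<in>S. u \<noteq> v \<longrightarrow> (u, v) \<in> parcs G)"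

definition clique_number :: "'a pair_pre_digraph \<Rightarrow> nat" where
  "clique_number G = Max (card ` {S. is_clique G S})"

definition independent_set :: "'a pair_pre_digraph \<Rightarrow> 'a set \<Rightarrow> bool" where
  "independent_set G S \<longleftrightarrow> S \<subseteq> pverts G \<and> (\<forall>u\<in>S. \<forall>v\<in>S. (u, v) \<notin> parcs G)"

definition monophonic_path :: "'a pair_pre_digraph \<Rightarrow> 'a list \<Rightarrow> bool" where
  "monophonic_path G p \<longleftrightarrow>
     vpath p (with_proj G) \<and>
     (\<forall>i j. i + 1 < j \<longrightarrow> j < length p \<longrightarrow> (p ! i, p ! j) \<notin> parcs G)"

definition monophonic_position_set :: "'a pair_pre_digraph \<Rightarrow> 'a set \<Rightarrow> bool" where
  "monophonic_position_set G M \<longleftrightarrow>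
     M \<subseteq> pverts G \<and>
     (\<forall>x\<in>M. \<forall>y\<in>M. \<forall>z\<in>M. x \<noteq> y \<longrightarrow> y \<noteq> z \<longrightarrow> x \<noteq> z \<longrightarrow>
        \<not> (\<exists>p. monophonic_path G p \<and> x \<in> set p \<and> y \<in> set p \<and> z \<in> set p))"

definition mp :: "'a pair_pre_digraph \<Rightarrow> nat" where
  "mp G = Max (card ` {M. monophonic_position_set G M})"

definition mp_i :: "'a pair_pre_digraph \<Rightarrow> nat" where
  "mp_i G = Max (card ` {M. independent_set G M \<and> monophonic_position_set G M})"

definition simplicial :: "'a pair_pre_digraph \<Rightarrow> 'a \<Rightarrow> bool" where
  "simplicial G v \<longleftrightarrow> v \<in> pverts G \<and> is_clique G {u. (v, u) \<in> parcs G}"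

definition simplicial_indicator :: "'a pair_pre_digraph \<Rightarrow> nat" (\<open>\<sigma>\<close>) where
  "\<sigma> G = (if \<exists>v. simplicial G v then 1 else 0)"

definition cartesian_product ::
  "'a pair_pre_digraph \<Rightarrow> 'b pair_pre_digraph \<Rightarrow> ('a \<times> 'b) pair_pre_digraph"
  (infixl \<open>\<box>\<close> 70) where
  "G \<box> H =
     \<lparr> pverts = pverts G \<times> pverts H,
       parcs = {((g1, h1), (g2, h2)) | g1 h1 g2 h2.
         ((g1, g2) \<in> parcs G \<and> h1 = h2 \<and> h1 \<in> pverts H) \<or>
         (g1 = g2 \<and> g1 \<in> pverts G \<and> (h1, h2) \<in> parcs H)} \<rparr>"

lemma pair_graph_cartesian_product:
  assumes "pair_graph G" and "pair_graph H"
  shows "pair_graph (G \<box> H)"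
proof -
  interpret G: pair_graph G by fact
  interpret H: pair_graph H by fact
  have sub: "parcs (G \<box> H) \<subseteq> (pverts G \<times> pverts H) \<times> (pverts G \<times> pverts H)"
    by (auto simp: cartesian_product_def
        dest: G.in_arcsD1 G.in_arcsD2 H.in_arcsD1 H.in_arcsD2)
  have fin: "finite (pverts G \<times> pverts H)"
    by (simp add: G.pair_finite_verts H.pair_finite_verts)
  show ?thesis
  proof unfold_locales
    show "finite (pverts (G \<box> H))"
      using fin by (simp add: cartesian_product_def)
    show "finite (parcs (G \<box> H))"
      using sub fin by (meson finite_SigmaI finite_subset)
    show "fst e \<in> pverts (G \<box> H)" "snd e \<in> pverts (G \<box> H)" if "e \<in> parcs (G \<box> H)" for e
      using that by (auto simp: cartesian_product_def
          dest: G.in_arcsD1 G.in_arcsD2 H.in_arcsD1 H.in_arcsD2)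
    show "fst e \<noteq> snd e" if "e \<in> parcs (G \<box> H)" for e
      using that G.pair_no_loops H.pair_no_loops by (fastforce simp: cartesian_product_def)
    show "symmetric (with_proj (G \<box> H))"
      using G.sym_arcs H.sym_arcs
      by (auto simp: symmetric_def sym_def cartesian_product_def arcs_ends_def arc_to_ends_def)
  qed
qed

text \<open>The upper bound fails if one factor has a single vertex: the product is then isomorphic to the
  other factor \<open>H\<close>, and for \<open>H\<close> consisting of two triangles sharing one vertex the four remaining
  vertices are in monophonic position, while \<open>clique_number H = 3\<close> and \<open>mp_i H = 2\<close>. Hence the upper
  bound is stated for factors with at least two vertices; the other parts need no such restriction.\<close>

end

theory Submission
  imports Defs
begin

text \<open>
  The lower bound holds because a triangle never lies on an induced path, so that a copy of a clique
  of one factor in a layer of the product is in monophonic position.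

  For the upper bound, let \<open>M\<close> be in monophonic position, with at least three vertices. Paths in the
  product can change layers at will, and a triple of vertices escapes all induced paths only for
  a good reason. First, a path of one factor through three vertices can be lifted: a detour with the
  shape of a U visits any three vertices above them (\<open>on_induced_path_lift_H\<close>). So wherever \<open>M\<close> projects
  injectively, its image is again in monophonic position. Secondly, a staircase, which alternates
  between layers of the two kinds, has chords only where the layers involved are adjacent
  (\<open>z_shaped_path\<close>). Trying the staircases through a triple of \<open>M\<close> in all orders leaves few possibilities.

  If no two vertices of \<open>M\<close> share a coordinate, every triple projects to a triangle in one of the
  factors, for all triples the same (\<open>general_position_triple\<close>), hence \<open>M\<close> is no larger than a clique.

  Otherwise two vertices of \<open>M\<close> share, say, their first coordinate \<open>a\<close>. If \<open>M\<close> is contained in the layer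
  of \<open>a\<close>, then a detour through a neighbouring layer shows that its projection to \<open>H\<close> cannot mix edges
  and non-edges: it is a clique or independent (\<open>layer_triple\<close>). If \<open>M\<close> leaves this layer, its first
  coordinates other than \<open>a\<close> are neighbours of \<open>a\<close>, and it projects injectively to an independent set of \<open>H\<close>
  (\<open>shared_coordinate_triple\<close>, \<open>clique_triple\<close>). Whenever the projection is independent, \<open>a\<close> must be
  simplicial: the layers of two nonadjacent neighbours of \<open>a\<close> would offer two independent detours, and a
  path with the shape of a W would visit three vertices of \<open>M\<close> (\<open>w_shaped_path\<close>). This is the origin of the
  term \<open>\<sigma> G * mp_i H\<close>; exchanging the factors gives the other one.

  Without simplicial vertices these two terms vanish, and the bounds coincide.
\<close>

section \<open>Induced paths given by their vertex sets\<close>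

text \<open>Only the ends and the vertex set of an induced path matter for position problems, so a path is
  represented by these. A path grows at its start by a vertex whose only neighbour on it is the old
  start; this makes gluing and cutting of paths statements about sets.\<close>

inductive induced_path :: "'a pair_pre_digraph \<Rightarrow> 'a \<Rightarrow> 'a set \<Rightarrow> 'a \<Rightarrow> bool"
  for G where
  trivial: "v \<in> pverts G \<Longrightarrow> induced_path G v {v} v"
| prepend: "(u, v) \<in> parcs G \<Longrightarrow> induced_path G v S w \<Longrightarrow> u \<notin> S \<Longrightarrow>
    (\<forall>q\<in>S. (u, q) \<in> parcs G \<longrightarrow> q = v) \<Longrightarrow> induced_path G u (insert u S) w"

definition on_induced_path :: "'a pair_pre_digraph \<Rightarrow> 'a set \<Rightarrow> bool" where
  "on_induced_path G X \<longleftrightarrow> (\<exists>s S t. induced_path G s S t \<and> X \<subseteq> S)"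

lemma induced_path_ends: "induced_path G s S t \<Longrightarrow> s \<in> S \<and> t \<in> S"
  by (induction rule: induced_path.induct) auto

lemma on_induced_pathI: "induced_path G s S t \<Longrightarrow> X \<subseteq> S \<Longrightarrow> on_induced_path G X"
  unfolding on_induced_path_def by blast

context pair_graph
begin

lemma adj_sym: "(u, v) \<in> parcs G \<Longrightarrow> (v, u) \<in> parcs G"
  using arcs_symmetric by blast

lemma adj_verts: "(u, v) \<in> parcs G \<Longrightarrow> u \<in> pverts G \<and> v \<in> pverts G"
  by (auto dest: in_arcsD1 in_arcsD2)

lemma adj_irrefl: "(v, v) \<notin> parcs G"
  using pair_no_loops by fastforce

lemma induced_path_verts: "induced_path G s S t \<Longrightarrow> S \<subseteq> pverts G"
  by (induction rule: induced_path.induct) (auto dest: adj_verts)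

lemma induced_path_edge:
  assumes "(u, v) \<in> parcs G"
  shows "induced_path G u {u, v} v"
  using assms adj_verts adj_irrefl
  by (auto intro!: induced_path.prepend[OF assms induced_path.trivial])

text \<open>Two induced paths meeting in an end glue to an induced path as soon as nothing else of
  the first touches anything else of the second. All paths of the product below are built this way.\<close>

lemma induced_path_join:
  assumes "induced_path G s S t" and "induced_path G t T u"
    and "\<And>p q. p \<in> S \<Longrightarrow> q \<in> T \<Longrightarrow> p \<noteq> t \<Longrightarrow> q \<noteq> t \<Longrightarrow> p \<noteq> q \<and> (p, q) \<notin> parcs G"
  shows "induced_path G s (S \<union> T) u"
  using assms
proof (induction rule: induced_path.induct)
  case (trivial v)
  then have "{v} \<union> T = T" using induced_path_ends by fast
  with trivial show ?case by metis
next
  case (prepend r v S t)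
  have IH: "induced_path G v (S \<union> T) u" using prepend by blast
  have tS: "t \<in> S" and tT: "t \<in> T" and vS: "v \<in> S"
    using prepend induced_path_ends by fast+
  have rt: "r \<noteq> t" using tS prepend by blast
  have 1: "r \<notin> S \<union> T" using prepend.prems(2)[of r r] prepend.hyps rt by blast
  have 2: "\<forall>q\<in>S \<union> T. (r, q) \<in> parcs G \<longrightarrow> q = v"
  proof (intro ballI impI)
    fix q assume q: "q \<in> S \<union> T" "(r, q) \<in> parcs G"
    show "q = v"
    proof (cases "q \<in> S")
      case True then show ?thesis using prepend q by blast
    next
      case False
      then have "q \<noteq> t" using tS by blast
      then show ?thesis using False q prepend.prems(2)[of r q] rt by blast
    qed
  qed
  have "induced_path G r (insert r (S \<union> T)) u"
    by (rule induced_path.prepend[OF prepend.hyps(1) IH 1 2])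
  then show ?case by simp
qed

text \<open>Besides the two pieces, the absence of edges between them is recorded: it is what allows
  one piece to be shortened and glued back.\<close>

lemma induced_path_split:
  assumes "induced_path G s S t" and "m \<in> S"
  shows "\<exists>A B. induced_path G s A m \<and> induced_path G m B t \<and> A \<union> B = S \<and> A \<inter> B = {m} \<and>
    (\<forall>p\<in>A - {m}. \<forall>q\<in>B - {m}. (p, q) \<notin> parcs G)"
  using assms
proof (induction rule: induced_path.induct)
  case (trivial v)
  then show ?case by (intro exI[of _ "{v}"]) (auto intro: induced_path.trivial)
next
  case (prepend u v S w)
  have path: "induced_path G u (insert u S) w" by (rule induced_path.prepend) fact+
  show ?case
  proof (cases "m = u")
    case True
    then show ?thesis using path prepend adj_verts
      by (intro exI[of _ "{u}"] exI[of _ "insert u S"]) (auto intro: induced_path.trivial)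
  next
    case False
    then obtain A B where AB: "induced_path G v A m" "induced_path G m B w"
      "A \<union> B = S" "A \<inter> B = {m}" "\<forall>p\<in>A - {m}. \<forall>q\<in>B - {m}. (p, q) \<notin> parcs G"
      using prepend by auto
    have vA: "v \<in> A" using AB induced_path_ends by fast
    have 1: "induced_path G u (insert u A) m"
      using prepend AB by (intro induced_path.prepend) auto
    have 2: "insert u A \<inter> B = {m}" using AB prepend False by auto
    have 3: "\<forall>p\<in>insert u A - {m}. \<forall>q\<in>B - {m}. (p, q) \<notin> parcs G"
      using AB vA prepend.hyps(4) by blast
    show ?thesis using 1 2 3 AB by (intro exI[of _ "insert u A"] exI[of _ B]) auto
  qed
qed

text \<open>One of three vertices of an induced path lies between the other two, and cutting the path at
  the outer two leaves an induced path between them.\<close>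

lemma induced_path_middle:
  assumes "induced_path G s S t" and "{x, y, z} \<subseteq> S" and "x \<noteq> y" "y \<noteq> z" "x \<noteq> z"
  shows "\<exists>a b c T. {a, b, c} = {x, y, z} \<and> induced_path G a T c \<and> b \<in> T"
  using assms
proof (induction arbitrary: x y z rule: induced_path.induct)
  case (trivial v) then show ?case by auto
next
  case (prepend r v S w)
  have path: "induced_path G r (insert r S) w" by (rule induced_path.prepend) fact+
  \<comment> \<open>Cutting at \<open>p\<close> leaves \<open>q\<close> either on the piece before \<open>p\<close> or on the piece after it; in the latter case
    the rest of the path is cut off at \<open>q\<close>.\<close>
  have from_start: "\<exists>b c T. {b, c} = {p, q} \<and> induced_path G r T c \<and> b \<in> T"
    if pq: "p \<in> S" "q \<in> S" for p q
  proof -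
    obtain A B where AB: "induced_path G r A p" "induced_path G p B w"
      "A \<union> B = insert r S" "A \<inter> B = {p}" "\<forall>u\<in>A - {p}. \<forall>v\<in>B - {p}. (u, v) \<notin> parcs G"
      using induced_path_split[OF path, of p] pq by auto
    show ?thesis
    proof (cases "q \<in> A")
      case True then show ?thesis using AB(1) by blast
    next
      case False
      then have "q \<in> B" using AB(3) pq by blast
      from induced_path_split[OF AB(2) this]
      obtain C D where CD: "induced_path G p C q" "C \<union> D = B" by auto
      have "induced_path G r (A \<union> C) q"
        using AB(4,5) CD(2) by (intro induced_path_join[OF AB(1) CD(1)]) blast
      moreover have "p \<in> A \<union> C" using induced_path_ends AB(1) by fast
      ultimately show ?thesis by blast
    qed
  qed
  consider "{x, y, z} \<subseteq> S" | "x = r" "y \<in> S" "z \<in> S" | "y = r" "x \<in> S" "z \<in> S"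
    | "z = r" "x \<in> S" "y \<in> S"
    using prepend.prems by auto
  then show ?case
  proof cases
    case 1 then show ?thesis using prepend.IH[of x y z] prepend.prems by blast
  next
    case 2
    then show ?thesis using from_start[of y z] by (metis insert_commute)
  next
    case 3
    then obtain b c T where "{b, c} = {x, z}" "induced_path G r T c" "b \<in> T"
      using from_start[of x z] by blast
    then show ?thesis using 3 by (intro exI[of _ r] exI[of _ b] exI[of _ c] exI[of _ T]) auto
  next
    case 4
    then obtain b c T where "{b, c} = {x, y}" "induced_path G r T c" "b \<in> T"
      using from_start[of x y] by blast
    then show ?thesis using 4 by (intro exI[of _ r] exI[of _ b] exI[of _ c] exI[of _ T]) auto
  qed
qed

lemma on_induced_path_middle:
  assumes "on_induced_path G {x, y, z}" and ne: "x \<noteq> y" "y \<noteq> z" "x \<noteq> z"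
  shows "\<exists>a b c T. {a, b, c} = {x, y, z} \<and> induced_path G a T c \<and> b \<in> T \<and> a \<noteq> c \<and>
    (a, c) \<notin> parcs G"
proof -
  obtain a b c T where abc: "{a, b, c} = {x, y, z}" "induced_path G a T c" "b \<in> T"
    using assms(1) induced_path_middle ne unfolding on_induced_path_def by metis
  have "card {x, y, z} = 3" using ne by simp
  then have d: "a \<noteq> b" "b \<noteq> c" "a \<noteq> c"
    unfolding abc(1)[symmetric] by (auto simp: card_insert_if split: if_splits)
  obtain A B where AB: "induced_path G a A b" "induced_path G b B c"
      "\<forall>u\<in>A - {b}. \<forall>v\<in>B - {b}. (u, v) \<notin> parcs G"
    using induced_path_split[OF abc(2,3)] by blast
  then have "(a, c) \<notin> parcs G"
    using induced_path_ends[OF AB(1)] induced_path_ends[OF AB(2)] d by blast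
  then show ?thesis using abc d by blast
qed

text \<open>The vertex \<open>u\<close> is attached at the last vertex of the path that is adjacent to it, and the part of
  the path before that vertex is dropped.\<close>

lemma induced_path_extend:
  assumes "induced_path G s S t" and "u \<notin> S" and "v \<in> S" and "(u, v) \<in> parcs G"
  shows "\<exists>T. induced_path G u T t"
  using assms
proof (induction arbitrary: v rule: induced_path.induct)
  case (trivial w)
  then show ?case by (auto intro: induced_path_edge)
next
  case (prepend r s S t)
  show ?case
  proof (cases "\<exists>q\<in>S. (u, q) \<in> parcs G")
    case True then show ?thesis using prepend by blast
  next
    case False
    have "induced_path G r (insert r S) t" by (rule induced_path.prepend) fact+
    then have "induced_path G u (insert u (insert r S)) t"
      using prepend.prems False by (intro induced_path.prepend[of u r]) auto
    then show ?thesis by blast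
  qed
qed

lemma induced_path_exists:
  assumes "connected (with_proj G)" and "u \<in> pverts G" and "v \<in> pverts G"
  shows "\<exists>S. induced_path G u S v"
proof -
  have sym: "symmetric (with_proj G)" using sym_arcs by simp
  have "u \<rightarrow>\<^sup>*\<^bsub>with_proj (mk_symmetric G)\<^esub> v"
    using assms by (auto simp: connected_def strongly_connected_def)
  then have "u \<rightarrow>\<^sup>*\<^bsub>with_proj G\<^esub> v"
    using reachable_mk_symmetric_eq[OF sym] by simp
  then show ?thesis
  proof (induction rule: converse_reachable_induct)
    case base
    then show ?case using induced_path.trivial[of v G] by auto
  next
    case (step x y)
    then obtain S where S: "induced_path G y S v" by blast
    have "(x, y) \<in> parcs G" using step by simp
    show ?case
    proof (cases "x \<in> S")
      case True
      from induced_path_split[OF S this] show ?thesis by auto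
    next
      case False
      moreover have "y \<in> S" using induced_path_ends[OF S] by simp
      ultimately show ?thesis using \<open>(x, y) \<in> parcs G\<close> by (rule induced_path_extend[OF S])
    qed
  qed
qed

lemma on_induced_path_of_two_edges:
  assumes "(x, y) \<in> parcs G" "(y, z) \<in> parcs G" "x \<noteq> z" "(x, z) \<notin> parcs G"
  shows "on_induced_path G {x, y, z}"
proof -
  have "induced_path G x (insert x {y, z}) z"
    using assms adj_irrefl by (intro induced_path.prepend[OF assms(1) induced_path_edge[OF assms(2)]]) auto
  then show ?thesis by (rule on_induced_pathI) auto
qed

text \<open>Two edges without the third form an induced path on all three vertices.\<close>

lemma not_exactly_two_edges:
  assumes off: "\<not> on_induced_path G {x, y, z}" and ne: "x \<noteq> y" "y \<noteq> z" "x \<noteq> z"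
  shows "(x, y) \<in> parcs G \<Longrightarrow> (y, z) \<in> parcs G \<Longrightarrow> (x, z) \<in> parcs G"
    and "(x, y) \<in> parcs G \<Longrightarrow> (x, z) \<in> parcs G \<Longrightarrow> (y, z) \<in> parcs G"
    and "(x, z) \<in> parcs G \<Longrightarrow> (y, z) \<in> parcs G \<Longrightarrow> (x, y) \<in> parcs G"
  using on_induced_path_of_two_edges[of x y z] on_induced_path_of_two_edges[of y x z]
    on_induced_path_of_two_edges[of x z y] off ne adj_sym
  by (auto simp: insert_commute)

text \<open>The two notions of induced path agree, so that position sets can be described by vertex sets of
  paths instead of lists.\<close>

lemma induced_path_of_monophonic:
  assumes "monophonic_path G p"
  shows "induced_path G (hd p) (set p) (last p)"
  using assms
proof (induction p)
  case Nil
  then show ?case by (simp add: monophonic_path_def vpath_def vwalk_def)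
next
  case (Cons u p)
  show ?case
  proof (cases p)
    case Nil
    then show ?thesis using Cons.prems
      by (auto simp: monophonic_path_def vpath_def vwalk_def intro: induced_path.trivial)
  next
    case (Cons v q)
    have nonadj: "(u, w) \<notin> parcs G" if w: "w \<in> set q" for w
    proof -
      obtain i where "i < length q" "w = q ! i" using w by (auto simp: in_set_conv_nth)
      moreover have "0 + 1 < Suc (Suc i) \<longrightarrow> Suc (Suc i) < length (u # p) \<longrightarrow>
          ((u # p) ! 0, (u # p) ! Suc (Suc i)) \<notin> parcs G"
        using Cons.prems unfolding monophonic_path_def by blast
      ultimately show ?thesis using Cons by simp
    qed
    have "monophonic_path G p"
      unfolding monophonic_path_def
    proof (intro conjI allI impI)
      show "vpath p (with_proj G)"
        using Cons.prems Cons by (auto simp: monophonic_path_def vpath_def vwalk_def)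
      fix i j assume "i + 1 < j" "j < length p"
      moreover have "Suc i + 1 < Suc j \<longrightarrow> Suc j < length (u # p) \<longrightarrow>
          ((u # p) ! Suc i, (u # p) ! Suc j) \<notin> parcs G"
        using Cons.prems unfolding monophonic_path_def by blast
      ultimately show "(p ! i, p ! j) \<notin> parcs G" by simp
    qed
    then have IH: "induced_path G v (set p) (last p)" using Cons.IH Cons by simp
    have "(u, v) \<in> parcs G" "u \<notin> set p"
      using Cons.prems Cons by (auto simp: monophonic_path_def vpath_def vwalk_def)
    then have "induced_path G u (insert u (set p)) (last p)"
      using nonadj Cons by (intro induced_path.prepend[OF _ IH]) auto
    then show ?thesis using Cons by simp
  qed
qed

lemma monophonic_of_induced_path:
  "induced_path G s S t \<Longrightarrow> \<exists>p. monophonic_path G p \<and> set p = S \<and> hd p = s"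
proof (induction rule: induced_path.induct)
  case (trivial v)
  then show ?case
    by (intro exI[of _ "[v]"]) (auto simp: monophonic_path_def vpath_def vwalk_def)
next
  case (prepend u v S w)
  then obtain p where p: "monophonic_path G p" "set p = S" "hd p = v" by blast
  then have "p \<noteq> []" by (auto simp: monophonic_path_def vpath_def vwalk_def)
  then obtain q where q: "p = v # q" using p by (cases p) auto
  have "monophonic_path G (u # p)"
    unfolding monophonic_path_def
  proof (intro conjI allI impI)
    show "vpath (u # p) (with_proj G)"
      using p q prepend.hyps adj_verts by (auto simp: monophonic_path_def vpath_def vwalk_def)
    fix i j assume ij: "i + 1 < j" "j < length (u # p)"
    then obtain k where k: "j = Suc (Suc k)" 
      by (metis add_lessD1 less_imp_Suc_add plus_1_eq_Suc add.commute)
    show "((u # p) ! i, (u # p) ! j) \<notin> parcs G"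
    proof (cases i)
      case 0
      have "q ! k \<in> set q" using ij k q by simp
      moreover have "v \<notin> set q" using p q by (auto simp: monophonic_path_def vpath_def)
      ultimately have "(u, q ! k) \<notin> parcs G"
        using prepend.hyps(4) p(2) q by auto
      then show ?thesis using 0 k q by simp
    next
      case (Suc i')
      then show ?thesis using ij k p(1) unfolding monophonic_path_def by simp
    qed
  qed
  then show ?case using p by (intro exI[of _ "u # p"]) auto
qed

lemma monophonic_position_set_iff:
  "monophonic_position_set G M \<longleftrightarrow> M \<subseteq> pverts G \<and>
    (\<forall>x\<in>M. \<forall>y\<in>M. \<forall>z\<in>M. x \<noteq> y \<longrightarrow> y \<noteq> z \<longrightarrow> x \<noteq> z \<longrightarrow> \<not> on_induced_path G {x, y, z})"
proof -
  have "(\<exists>p. monophonic_path G p \<and> x \<in> set p \<and> y \<in> set p \<and> z \<in> set p) \<longleftrightarrow>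
      on_induced_path G {x, y, z}" for x y z
    unfolding on_induced_path_def
    using induced_path_of_monophonic monophonic_of_induced_path by (metis empty_subsetI insert_subset)
  then show ?thesis unfolding monophonic_position_set_def by presburger
qed

end

section \<open>Bending induced paths in a Cartesian product\<close>

lemma verts_product [simp]: "pverts (G \<box> H) = pverts G \<times> pverts H"
  by (simp add: cartesian_product_def)

lemma adj_product [simp]:
  "((a, x), (b, y)) \<in> parcs (G \<box> H) \<longleftrightarrow>
    ((a, b) \<in> parcs G \<and> x = y \<and> x \<in> pverts H) \<or> (a = b \<and> a \<in> pverts G \<and> (x, y) \<in> parcs H)"
  by (auto simp: cartesian_product_def)

lemma adj_product_swap:
  "(prod.swap u, prod.swap v) \<in> parcs (H \<box> G) \<longleftrightarrow> (u, v) \<in> parcs (G \<box> H)"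
  by (cases u; cases v) auto

text \<open>The situation is symmetric in the two factors, and many facts are needed for both orders. They are
  proved once for \<open>G\<close> and \<open>H\<close> in this order, and transported by exchanging coordinates.\<close>

locale connected_factors = G: pair_graph G + H: pair_graph H
  for G :: "'a pair_pre_digraph" and H :: "'b pair_pre_digraph" +
  assumes connected_G: "connected (with_proj G)" and connected_H: "connected (with_proj H)"
begin

lemma swapped: "connected_factors H G"
  using connected_G connected_H by unfold_locales

sublocale product: pair_graph "G \<box> H"
  by (rule pair_graph_cartesian_product) unfold_locales

lemma induced_path_layer_G:
  "induced_path G s S t \<Longrightarrow> h \<in> pverts H \<Longrightarrow> induced_path (G \<box> H) (s, h) (S \<times> {h}) (t, h)"
proof (induction rule: induced_path.induct)
  case (trivial v)
  then show ?case using induced_path.trivial[of "(v, h)" "G \<box> H"] by simp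
next
  case (prepend u v S w)
  have "((u, h), (v, h)) \<in> parcs (G \<box> H)" using prepend.hyps(1) prepend.prems by simp
  moreover have "(u, h) \<notin> S \<times> {h}" using prepend.hyps(3) by simp
  moreover have "\<forall>q\<in>S \<times> {h}. ((u, h), q) \<in> parcs (G \<box> H) \<longrightarrow> q = (v, h)"
    using prepend.hyps(4) H.adj_irrefl[of h] by (simp add: Ball_def)
  ultimately have "induced_path (G \<box> H) (u, h) (insert (u, h) (S \<times> {h})) (w, h)"
    using prepend.IH[OF prepend.prems] by (metis induced_path.prepend)
  moreover have "insert (u, h) (S \<times> {h}) = insert u S \<times> {h}" by auto
  ultimately show ?case by (simp only:)
qed

lemma induced_path_layer_H:
  "induced_path H s S t \<Longrightarrow> g \<in> pverts G \<Longrightarrow> induced_path (G \<box> H) (g, s) ({g} \<times> S) (g, t)"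
proof (induction rule: induced_path.induct)
  case (trivial v)
  then show ?case using induced_path.trivial[of "(g, v)" "G \<box> H"] by simp
next
  case (prepend u v S w)
  have "((g, u), (g, v)) \<in> parcs (G \<box> H)" using prepend.hyps(1) prepend.prems by simp
  moreover have "(g, u) \<notin> {g} \<times> S" using prepend.hyps(3) by simp
  moreover have "\<forall>q\<in>{g} \<times> S. ((g, u), q) \<in> parcs (G \<box> H) \<longrightarrow> q = (g, v)"
    using prepend.hyps(4) G.adj_irrefl[of g] by (simp add: Ball_def)
  ultimately have "induced_path (G \<box> H) (g, u) (insert (g, u) ({g} \<times> S)) (g, w)"
    using prepend.IH[OF prepend.prems] by (metis induced_path.prepend)
  moreover have "insert (g, u) ({g} \<times> S) = {g} \<times> insert u S" by auto
  ultimately show ?case by (simp only:)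
qed

lemma induced_path_swap:
  "induced_path (G \<box> H) s S t \<Longrightarrow> induced_path (H \<box> G) (prod.swap s) (prod.swap ` S) (prod.swap t)"
proof (induction rule: induced_path.induct)
  case (trivial v)
  then have "prod.swap v \<in> pverts (H \<box> G)" by (cases v) simp
  from induced_path.trivial[OF this] show ?case by simp
next
  case (prepend u v S w)
  then have "induced_path (H \<box> G) (prod.swap u) (insert (prod.swap u) (prod.swap ` S)) (prod.swap w)"
    by (intro induced_path.prepend[of _ "prod.swap v"])
      (simp_all add: adj_product_swap inj_image_mem_iff[OF inj_swap])
  then show ?case by simp
qed

lemma on_induced_path_swap:
  "on_induced_path (G \<box> H) X \<Longrightarrow> on_induced_path (H \<box> G) (prod.swap ` X)"
proof -
  assume "on_induced_path (G \<box> H) X"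
  then obtain s S t where "induced_path (G \<box> H) s S t" "X \<subseteq> S"
    unfolding on_induced_path_def by (elim exE conjE)
  then show ?thesis by (intro on_induced_pathI[OF induced_path_swap] image_mono)
qed

text \<open>Run along the layer of \<open>x\<close>, cross over inside the layer of \<open>b\<close>, return along the layer of \<open>z\<close>. The
  two horizontal parts lie in different, nonadjacent layers, so no chord can join them, however the
  paths \<open>P\<close> and \<open>P'\<close> overlap in \<open>G\<close>.\<close>

lemma u_shaped_path:
  assumes P: "induced_path G a P b" and R: "induced_path H x R z" and P': "induced_path G b P' c"
    and xz: "x \<noteq> z" "(x, z) \<notin> parcs H"
  shows "induced_path (G \<box> H) (a, x) (P \<times> {x} \<union> {b} \<times> R \<union> P' \<times> {z}) (c, z)"
proof -
  have V: "b \<in> pverts G" "x \<in> pverts H" "z \<in> pverts H"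
    using G.induced_path_verts[OF P] H.induced_path_verts[OF R] induced_path_ends[OF P]
      induced_path_ends[OF R] by auto
  have "induced_path (G \<box> H) (a, x) (P \<times> {x} \<union> {b} \<times> R) (b, z)"
    using induced_path_layer_G[OF P V(2)] induced_path_layer_H[OF R V(1)]
    by (rule product.induced_path_join) auto
  then show ?thesis
    using induced_path_layer_G[OF P' V(3)]
    by (rule product.induced_path_join) (use xz in auto)
qed

text \<open>A staircase with four pieces. Chords can only join pieces that are not consecutive: the two
  horizontal ones, if their layers are adjacent and \<open>P\<close> and \<open>P'\<close> share more than the corner; likewise the
  two vertical ones; and the first and the last, which is excluded by \<open>c \<notin> P\<close> and \<open>x \<notin> Q'\<close>.
  Trivial pieces are allowed, so that shorter staircases are covered as well.\<close>

lemma z_shaped_path: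
  assumes P: "induced_path G a P b" and Q: "induced_path H x Q y"
    and P': "induced_path G b P' c" and Q': "induced_path H y Q' z"
    and ne: "b \<noteq> c" "x \<noteq> y"
    and off: "c \<notin> P" "x \<notin> Q'"
    and PP': "(x, y) \<notin> parcs H \<or> P \<inter> P' = {b}"
    and QQ': "(b, c) \<notin> parcs G \<or> Q \<inter> Q' = {y}"
  shows "induced_path (G \<box> H) (a, x) (P \<times> {x} \<union> {b} \<times> Q \<union> P' \<times> {y} \<union> {c} \<times> Q') (c, z)"
proof -
  have V: "b \<in> pverts G" "c \<in> pverts G" "x \<in> pverts H" "y \<in> pverts H"
    using G.induced_path_verts[OF P'] H.induced_path_verts[OF Q] induced_path_ends[OF P']
      induced_path_ends[OF Q] by auto
  have "induced_path (G \<box> H) (a, x) (P \<times> {x} \<union> {b} \<times> Q) (b, y)"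
    using induced_path_layer_G[OF P V(3)] induced_path_layer_H[OF Q V(1)]
    by (rule product.induced_path_join) auto
  then have "induced_path (G \<box> H) (a, x) (P \<times> {x} \<union> {b} \<times> Q \<union> P' \<times> {y}) (c, y)"
    using induced_path_layer_G[OF P' V(4)]
  proof (rule product.induced_path_join)
    fix p q
    assume p: "p \<in> P \<times> {x} \<union> {b} \<times> Q" "p \<noteq> (b, y)"
      and q: "q \<in> P' \<times> {y}" "q \<noteq> (b, y)"
    obtain q' where q': "q = (q', y)" "q' \<in> P'" "q' \<noteq> b" using q by auto
    have P: "q' \<notin> P" if "(x, y) \<in> parcs H" using that PP' q' by auto
    consider p' where "p = (p', x)" "p' \<in> P" | p' where "p = (b, p')" "p' \<noteq> y"
      using p by auto
    then show "p \<noteq> q \<and> (p, q) \<notin> parcs (G \<box> H)"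
      by cases (use ne q' P in auto)
  qed
  then show ?thesis using induced_path_layer_H[OF Q' V(2)]
  proof (rule product.induced_path_join)
    fix p q
    assume p: "p \<in> P \<times> {x} \<union> {b} \<times> Q \<union> P' \<times> {y}" "p \<noteq> (c, y)"
      and q: "q \<in> {c} \<times> Q'" "q \<noteq> (c, y)"
    obtain q' where q': "q = (c, q')" "q' \<in> Q'" "q' \<noteq> y" using q by auto
    have Q: "q' \<notin> Q" if "(b, c) \<in> parcs G" using that QQ' q' by auto
    consider p' where "p = (p', x)" "p' \<in> P" | p' where "p = (b, p')" "p' \<in> Q"
      | p' where "p = (p', y)" "p' \<noteq> c" using p by auto
    then show "p \<noteq> q \<and> (p, q) \<notin> parcs (G \<box> H)"
      by cases (use ne off q' Q in auto)
  qed
qed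

text \<open>If \<open>a\<close> has two nonadjacent neighbours \<open>e\<close> and \<open>d\<close>, the layers of \<open>e\<close> and \<open>d\<close> can carry arbitrary paths
  independently of each other. The path leaves the layer of \<open>a\<close> at \<open>x\<close>, travels in the layer of \<open>e\<close>, touches
  the layer of \<open>a\<close> only at \<open>y\<close>, and travels on in the layer of \<open>d\<close>. The choice \<open>c = a\<close> is included: then
  the path comes back to the layer of \<open>a\<close> once more.\<close>

lemma w_shaped_path:
  assumes e: "(a, e) \<in> parcs G" and d: "(a, d) \<in> parcs G" and ed: "e \<noteq> d" "(e, d) \<notin> parcs G"
    and P: "induced_path H x P y" "z \<notin> P" and Q: "induced_path H y Q z" "x \<notin> Q"
    and xyz: "(x, y) \<notin> parcs H" "(y, z) \<notin> parcs H" "(x, z) \<notin> parcs H"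
    and c: "c = d \<or> (d, c) \<in> parcs G" "c \<noteq> e"
  shows "on_induced_path (G \<box> H) {(a, x), (a, y), (c, z)}"
proof -
  have ne: "x \<noteq> y" "y \<noteq> z" "x \<noteq> z"
    using P Q induced_path_ends[OF P(1)] induced_path_ends[OF Q(1)] by auto
  define T where "T = (if c = d then {d} else {d, c})"
  have T: "induced_path G d T c"
    unfolding T_def using c(1) G.induced_path_edge[of d c] induced_path.trivial[of d G] G.adj_verts[OF d]
    by (cases "c = d") simp_all
  have 1: "induced_path (G \<box> H) (a, x) ({a, e} \<times> {x} \<union> {e} \<times> P \<union> {e, a} \<times> {y}) (a, y)"
    by (rule u_shaped_path[OF G.induced_path_edge[OF e] P(1) G.induced_path_edge[OF G.adj_sym[OF e]]
      ne(1) xyz(1)])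
  have 2: "induced_path (G \<box> H) (a, y) ({a, d} \<times> {y} \<union> {d} \<times> Q \<union> T \<times> {z}) (c, z)"
    by (rule u_shaped_path[OF G.induced_path_edge[OF d] Q(1) T ne(2) xyz(2)])
  have path: "induced_path (G \<box> H) (a, x) (({a, e} \<times> {x} \<union> {e} \<times> P \<union> {e, a} \<times> {y}) \<union>
      ({a, d} \<times> {y} \<union> {d} \<times> Q \<union> T \<times> {z})) (c, z)"
  proof (rule product.induced_path_join[OF 1 2])
    fix p q
    assume p: "p \<in> {a, e} \<times> {x} \<union> {e} \<times> P \<union> {e, a} \<times> {y}" "p \<noteq> (a, y)"
      and q: "q \<in> {a, d} \<times> {y} \<union> {d} \<times> Q \<union> T \<times> {z}" "q \<noteq> (a, y)"
    have "p = (a, x) \<or> (\<exists>p'\<in>P. p = (e, p'))"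
      using p induced_path_ends[OF P(1)] by auto
    moreover have "q = (c, z) \<or> (\<exists>q'\<in>Q. q = (d, q'))"
      using q induced_path_ends[OF Q(1)] by (auto simp: T_def split: if_splits)
    ultimately show "p \<noteq> q \<and> (p, q) \<notin> parcs (G \<box> H)"
      using ne ed xyz(3) c(2) P(2) Q(2) d G.adj_irrefl[of d] by auto
  qed
  have "c \<in> T" using induced_path_ends[OF T] by simp
  then show ?thesis by (intro on_induced_pathI[OF path]) auto
qed

section \<open>Triples of the product that share no induced path\<close>

text \<open>If \<open>y\<close>, say, lies between \<open>x\<close> and \<open>z\<close> on an induced path of \<open>H\<close>, then \<open>x\<close> and \<open>z\<close> are not adjacent, and
  a U-shaped path whose crossing in the layer of \<open>b\<close> is this induced path visits all three vertices.
  Hence projections of position sets are position sets wherever they are injective.\<close>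

lemma on_induced_path_lift_H:
  assumes on: "on_induced_path H {x, y, z}" and ne: "x \<noteq> y" "y \<noteq> z" "x \<noteq> z"
    and V: "a \<in> pverts G" "b \<in> pverts G" "c \<in> pverts G"
  shows "on_induced_path (G \<box> H) {(a, x), (b, y), (c, z)}"
proof -
  obtain p q r T where pqr: "{p, q, r} = {x, y, z}" "induced_path H p T r" "q \<in> T"
      and pr: "p \<noteq> r" "(p, r) \<notin> parcs H"
    using H.on_induced_path_middle[OF on ne] by blast
  \<comment> \<open>Which of \<open>x\<close>, \<open>y\<close>, \<open>z\<close> is the middle one is unknown, so first coordinates are attached by a function.\<close>
  define f where "f w = (if w = x then a else if w = y then b else c)" for w
  have fV: "f w \<in> pverts G" for w using V by (simp add: f_def)
  obtain P P' where P: "induced_path G (f p) P (f q)" "induced_path G (f q) P' (f r)"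
    using G.induced_path_exists[OF connected_G] fV by meson
  have "{(a, x), (b, y), (c, z)} = (\<lambda>w. (f w, w)) ` {x, y, z}" using ne by (simp add: f_def)
  also have "\<dots> = (\<lambda>w. (f w, w)) ` {p, q, r}" using pqr(1) by simp
  also have "\<dots> \<subseteq> P \<times> {p} \<union> {f q} \<times> T \<union> P' \<times> {r}"
    using induced_path_ends[OF P(1)] induced_path_ends[OF P(2)] pqr(3) by auto
  finally show ?thesis
    by (rule on_induced_pathI[OF u_shaped_path[OF P(1) pqr(2) P(2) pr]])
qed

text \<open>The staircase with trivial first and last piece.\<close>

lemma on_induced_path_corner:
  assumes "a \<in> pverts G" "c \<in> pverts G" "x \<in> pverts H" "y \<in> pverts H" "a \<noteq> c" "x \<noteq> y"
  shows "on_induced_path (G \<box> H) {(a, x), (a, y), (c, y)}"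
proof -
  obtain Q P' where Q: "induced_path H x Q y" and P': "induced_path G a P' c"
    using assms G.induced_path_exists[OF connected_G] H.induced_path_exists[OF connected_H] by meson
  have "induced_path (G \<box> H) (a, x) ({a} \<times> {x} \<union> {a} \<times> Q \<union> P' \<times> {y} \<union> {c} \<times> {y}) (c, y)"
    using assms induced_path_ends[OF Q] induced_path_ends[OF P']
    by (intro z_shaped_path Q P' induced_path.trivial) auto
  then show ?thesis
    using induced_path_ends[OF Q] by (intro on_induced_pathI) auto
qed

text \<open>When \<open>x\<close>, \<open>y\<close>, \<open>z\<close> share no induced path of \<open>H\<close>, every induced path between two of them avoids the third.
  This takes care of most side conditions of the staircase; an edge of \<open>H\<close> at \<open>y\<close> makes the two vertical
  pieces disjoint apart from the corner, since one of them can be chosen to be that edge.\<close>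

lemma on_induced_path_zigzag:
  assumes V: "x \<in> pverts H" "y \<in> pverts H" "z \<in> pverts H" and ne: "x \<noteq> y" "y \<noteq> z" "x \<noteq> z"
    and off: "\<not> on_induced_path H {x, y, z}"
    and P: "induced_path G a P b" and P': "induced_path G b P' c" and bc: "b \<noteq> c" "c \<notin> P"
    and PP': "(x, y) \<notin> parcs H \<or> P \<inter> P' = {b}"
    and c: "(b, c) \<notin> parcs G \<or> (x, y) \<in> parcs H \<or> (y, z) \<in> parcs H"
  shows "on_induced_path (G \<box> H) {(a, x), (b, y), (c, z)}"
proof -
  have avoid1: "x \<notin> Q'" if "induced_path H y Q' z" for Q'
    using off on_induced_pathI[OF that, of "{x, y, z}"] induced_path_ends[OF that] by auto
  have avoid3: "z \<notin> Q" if "induced_path H x Q y" for Q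
    using off on_induced_pathI[OF that, of "{x, y, z}"] induced_path_ends[OF that] by auto
  have "\<exists>Q Q'. induced_path H x Q y \<and> induced_path H y Q' z \<and> ((b, c) \<notin> parcs G \<or> Q \<inter> Q' = {y})"
  proof -
    obtain Q Q' where Q: "induced_path H x Q y" and Q': "induced_path H y Q' z"
      using H.induced_path_exists[OF connected_H] V by meson
    consider "(b, c) \<notin> parcs G" | "(x, y) \<in> parcs H" | "(y, z) \<in> parcs H" using c by blast
    then show ?thesis
    proof cases
      case 1 then show ?thesis using Q Q' by blast
    next
      case 2
      then have "{x, y} \<inter> Q' = {y}" using avoid1[OF Q'] induced_path_ends[OF Q'] by auto
      then show ?thesis using H.induced_path_edge[OF 2] Q' by blast
    next
      case 3
      then have "Q \<inter> {y, z} = {y}" using avoid3[OF Q] induced_path_ends[OF Q] by auto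
      then show ?thesis using H.induced_path_edge[OF 3] Q by blast
    qed
  qed
  then obtain Q Q' where Q: "induced_path H x Q y" "induced_path H y Q' z"
    "(b, c) \<notin> parcs G \<or> Q \<inter> Q' = {y}" by blast
  show ?thesis
    using induced_path_ends[OF P] induced_path_ends[OF Q(1)] induced_path_ends[OF Q(2)]
    by (intro on_induced_pathI[OF z_shaped_path[OF P Q(1) P' Q(2) bc(1) ne(1) bc(2) avoid1[OF Q(2)] PP' Q(3)]])
      auto
qed

text \<open>The staircases used here have a trivial first piece in the layer of \<open>a\<close>. They exist unless \<open>a\<close> and \<open>c\<close>
  are adjacent, and also if \<open>H\<close> has an edge among \<open>x\<close>, \<open>y\<close>, \<open>z\<close>. Stars show that the remaining case does
  occur: in the product of an edge with a star, the leaves, each taken in one of the two copies of the star,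
  are in monophonic position.\<close>

lemma shared_coordinate_triple:
  assumes V: "a \<in> pverts G" "c \<in> pverts G" "x \<in> pverts H" "y \<in> pverts H" "z \<in> pverts H"
    and off: "\<not> on_induced_path (G \<box> H) {(a, x), (a, y), (c, z)}" and ne: "x \<noteq> y" "a \<noteq> c"
  shows "(a, c) \<in> parcs G" and "x \<noteq> z" and "y \<noteq> z"
    and "(x, y) \<notin> parcs H" and "(y, z) \<notin> parcs H" and "(x, z) \<notin> parcs H"
proof -
  show xz: "x \<noteq> z"
    using on_induced_path_corner[of a c y x] V ne off by (auto simp: insert_commute)
  show yz: "y \<noteq> z"
    using on_induced_path_corner[of a c x y] V ne off by auto
  have offH: "\<not> on_induced_path H {x, y, z}"
    using on_induced_path_lift_H[of x y z a a c] V ne xz yz off by blast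
  obtain P' where P': "induced_path G a P' c" using G.induced_path_exists[OF connected_G] V by meson
  have P: "induced_path G a {a} a" using V by (intro induced_path.trivial)
  have PP': "{a} \<inter> P' = {a}" using induced_path_ends[OF P'] by auto
  have "\<not> ((a, c) \<notin> parcs G \<or> (x, y) \<in> parcs H \<or> (y, z) \<in> parcs H)"
    using on_induced_path_zigzag[OF V(3-5) ne(1) yz xz offH P P'] PP' ne(2) off by auto
  moreover have "\<not> ((a, c) \<notin> parcs G \<or> (y, x) \<in> parcs H \<or> (x, z) \<in> parcs H)"
    using on_induced_path_zigzag[OF V(4,3,5) ne(1)[symmetric] xz yz _ P P'] PP' ne(2) off offH
    by (auto simp: insert_commute)
  ultimately show "(a, c) \<in> parcs G" "(x, y) \<notin> parcs H" "(y, z) \<notin> parcs H" "(x, z) \<notin> parcs H"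
    by auto
qed

text \<open>If \<open>a\<close>, \<open>b\<close>, \<open>c\<close> form a triangle, both horizontal pieces of the staircase can be single edges that meet
  only in the corner; an edge of \<open>H\<close> among \<open>x\<close>, \<open>y\<close>, \<open>z\<close> does the same for the vertical ones.\<close>

lemma clique_triple:
  assumes V: "x \<in> pverts H" "y \<in> pverts H" "z \<in> pverts H" and ne: "x \<noteq> y" "y \<noteq> z" "x \<noteq> z"
    and off: "\<not> on_induced_path (G \<box> H) {(a, x), (b, y), (c, z)}"
    and abc: "(a, b) \<in> parcs G" "(b, c) \<in> parcs G" "(a, c) \<in> parcs G"
  shows "(x, y) \<notin> parcs H" and "(y, z) \<notin> parcs H" and "(x, z) \<notin> parcs H"
proof -
  have offH: "\<not> on_induced_path H {x, y, z}"
    using on_induced_path_lift_H[of x y z a b c] ne G.adj_verts[OF abc(1)] G.adj_verts[OF abc(2)] off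
    by blast
  have d: "a \<noteq> b" "b \<noteq> c" "a \<noteq> c" using abc G.adj_irrefl by auto
  have "\<not> ((x, y) \<in> parcs H \<or> (y, z) \<in> parcs H)"
    using on_induced_path_zigzag[OF V ne offH G.induced_path_edge[OF abc(1)] G.induced_path_edge[OF abc(2)]]
      d off by auto
  moreover have "\<not> ((y, x) \<in> parcs H \<or> (x, z) \<in> parcs H)"
    using on_induced_path_zigzag[OF V(2,1,3) ne(1)[symmetric] ne(3,2) _
        G.induced_path_edge[OF G.adj_sym[OF abc(1)]] G.induced_path_edge[OF abc(3)]]
      d off offH by (auto simp: insert_commute)
  ultimately show "(x, y) \<notin> parcs H" "(y, z) \<notin> parcs H" "(x, z) \<notin> parcs H" by auto
qed

text \<open>Applied to all six orders of the three vertices, this says that a missing edge of \<open>H\<close> at one pair and a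
  missing edge of \<open>G\<close> at another pair cannot both occur: then neither two horizontal nor two vertical pieces
  of the staircase lie in adjacent layers.\<close>

lemma non_edge_pair:
  assumes V: "{a, b, c} \<subseteq> pverts G" "{x, y, z} \<subseteq> pverts H"
    and ne: "x \<noteq> y" "y \<noteq> z" "x \<noteq> z" and bc: "b \<noteq> c"
    and offG: "\<not> on_induced_path G {a, b, c}" and offH: "\<not> on_induced_path H {x, y, z}"
    and off: "\<not> on_induced_path (G \<box> H) {(a, x), (b, y), (c, z)}"
  shows "(x, y) \<in> parcs H \<or> (b, c) \<in> parcs G"
proof (rule ccontr)
  assume no_edge: "\<not> ?thesis"
  obtain P P' where P: "induced_path G a P b" "induced_path G b P' c"
    using G.induced_path_exists[OF connected_G] V by (meson insert_subset)
  have "c \<notin> P"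
    using offG on_induced_pathI[OF P(1), of "{a, b, c}"] induced_path_ends[OF P(1)] by auto
  then show False
    using on_induced_path_zigzag[OF _ _ _ ne offH P bc] V off no_edge by auto
qed

text \<open>A missing edge of \<open>G\<close> at one pair forces the edges of \<open>H\<close> at the two other pairs. As \<open>H\<close> cannot have
  exactly two edges among \<open>x\<close>, \<open>y\<close>, \<open>z\<close>, it has all three, and then the triangle case with exchanged factors
  applies.\<close>

lemma general_position_triple:
  assumes V: "{a, b, c} \<subseteq> pverts G" "{x, y, z} \<subseteq> pverts H"
    and ne: "x \<noteq> y" "y \<noteq> z" "x \<noteq> z" and ne': "a \<noteq> b" "b \<noteq> c" "a \<noteq> c"
    and off: "\<not> on_induced_path (G \<box> H) {(a, x), (b, y), (c, z)}"
  shows "(a, b) \<in> parcs G \<and> (b, c) \<in> parcs G \<and> (a, c) \<in> parcs G \<or>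
    (a, b) \<notin> parcs G \<and> (b, c) \<notin> parcs G \<and> (a, c) \<notin> parcs G \<and>
    (x, y) \<in> parcs H \<and> (y, z) \<in> parcs H \<and> (x, z) \<in> parcs H"
proof -
  interpret swap: connected_factors H G by (rule swapped)
  have off': "\<not> on_induced_path (H \<box> G) {(x, a), (y, b), (z, c)}"
    using swap.on_induced_path_swap[of "{(x, a), (y, b), (z, c)}"] off by auto
  have offH: "\<not> on_induced_path H {x, y, z}"
    using on_induced_path_lift_H[of x y z a b c] V ne off by auto
  have offG: "\<not> on_induced_path G {a, b, c}"
    using swap.on_induced_path_lift_H[of a b c x y z] V ne' off' by auto
  note s = G.adj_sym H.adj_sym
  have 1: "(x, y) \<in> parcs H \<or> (b, c) \<in> parcs G"
    using non_edge_pair[of a b c x y z] V ne ne' offG offH off by auto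
  have 2: "(x, y) \<in> parcs H \<or> (a, c) \<in> parcs G"
    using non_edge_pair[of b a c y x z] V ne ne' offG offH off s by (auto simp: insert_commute)
  have 3: "(y, z) \<in> parcs H \<or> (a, b) \<in> parcs G"
    using non_edge_pair[of c b a z y x] V ne ne' offG offH off s by (auto simp: insert_commute)
  have 4: "(y, z) \<in> parcs H \<or> (a, c) \<in> parcs G"
    using non_edge_pair[of b c a y z x] V ne ne' offG offH off s by (auto simp: insert_commute)
  have 5: "(x, z) \<in> parcs H \<or> (a, b) \<in> parcs G"
    using non_edge_pair[of c a b z x y] V ne ne' offG offH off s by (auto simp: insert_commute)
  have 6: "(x, z) \<in> parcs H \<or> (b, c) \<in> parcs G"
    using non_edge_pair[of a c b x z y] V ne ne' offG offH off s by (auto simp: insert_commute)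
  show ?thesis
  proof (cases "(a, b) \<in> parcs G \<and> (b, c) \<in> parcs G \<and> (a, c) \<in> parcs G")
    case False
    then have e: "(x, y) \<in> parcs H" "(y, z) \<in> parcs H" "(x, z) \<in> parcs H"
      using 1 2 3 4 5 6 H.not_exactly_two_edges[OF offH ne] by blast+
    then show ?thesis using swap.clique_triple[OF _ _ _ ne' off' e] V by auto
  qed blast
qed

text \<open>Start with the edge from \<open>x\<close> to \<open>y\<close>, then reach \<open>z\<close> by a U-shaped detour through the layer of a neighbour
  \<open>b\<close>. Without a neighbouring layer there is no way around, as two triangles with a common vertex show.\<close>

lemma layer_triple_edge:
  assumes V: "(a, b) \<in> parcs G" "{x, y, z} \<subseteq> pverts H"
    and ne: "x \<noteq> y" "y \<noteq> z" "x \<noteq> z"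
    and e: "(x, y) \<in> parcs H" "(y, z) \<notin> parcs H" "(x, z) \<notin> parcs H"
  shows "on_induced_path (G \<box> H) {(a, x), (a, y), (a, z)}"
proof (rule ccontr)
  assume off: "\<not> ?thesis"
  have aV: "a \<in> pverts G" using G.adj_verts[OF V(1)] by simp
  have offH: "\<not> on_induced_path H {x, y, z}"
    using on_induced_path_lift_H[of x y z a a a] aV ne off by blast
  obtain Q where Q: "induced_path H y Q z" using H.induced_path_exists[OF connected_H] V by (meson insert_subset)
  have xQ: "x \<notin> Q"
    using offH on_induced_pathI[OF Q, of "{x, y, z}"] induced_path_ends[OF Q] by auto
  let ?S = "{a, b} \<times> {y} \<union> {b} \<times> Q \<union> {b, a} \<times> {z}"
  have path: "induced_path (G \<box> H) (a, y) ?S (a, z)"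
    using ne e by (intro u_shaped_path G.induced_path_edge V G.adj_sym[OF V(1)] Q)
  have S: "q = (a, y) \<or> q = (a, z) \<or> (\<exists>q'\<in>Q. q = (b, q'))" if "q \<in> ?S" for q
    using that induced_path_ends[OF Q] by auto
  have ab: "a \<noteq> b" using V(1) G.adj_irrefl by auto
  have "induced_path (G \<box> H) (a, x) (insert (a, x) ?S) (a, z)"
  proof (rule induced_path.prepend[OF _ path])
    show "((a, x), (a, y)) \<in> parcs (G \<box> H)" using e aV by simp
    show "(a, x) \<notin> ?S" using ne ab by auto
    show "\<forall>q\<in>?S. ((a, x), q) \<in> parcs (G \<box> H) \<longrightarrow> q = (a, y)"
    proof (intro ballI impI)
      fix q assume "q \<in> ?S" "((a, x), q) \<in> parcs (G \<box> H)"
      then show "q = (a, y)" using S[of q] xQ ab e ne by auto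
    qed
  qed
  then show False using off by (auto intro: on_induced_pathI)
qed

text \<open>Among three vertices there are not exactly two edges, by the induced path with three vertices, and not
  exactly one, by the detour of the preceding lemma.\<close>

lemma layer_triple:
  assumes V: "(a, b) \<in> parcs G" "{x, y, z} \<subseteq> pverts H"
    and ne: "x \<noteq> y" "y \<noteq> z" "x \<noteq> z"
    and off: "\<not> on_induced_path (G \<box> H) {(a, x), (a, y), (a, z)}"
  shows "(x, y) \<in> parcs H \<and> (y, z) \<in> parcs H \<and> (x, z) \<in> parcs H \<or>
    (x, y) \<notin> parcs H \<and> (y, z) \<notin> parcs H \<and> (x, z) \<notin> parcs H"
proof -
  have aV: "a \<in> pverts G" using G.adj_verts[OF V(1)] by simp
  have offH: "\<not> on_induced_path H {x, y, z}"
    using on_induced_path_lift_H[of x y z a a a] aV ne off by blast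
  note s = H.adj_sym
  have d1: "(y, z) \<in> parcs H \<or> (x, z) \<in> parcs H" if "(x, y) \<in> parcs H"
    using layer_triple_edge[of a b x y z] V ne that off by auto
  have d2: "(x, y) \<in> parcs H \<or> (x, z) \<in> parcs H" if "(y, z) \<in> parcs H"
    using layer_triple_edge[of a b y z x] V ne that off s by (auto simp: insert_commute)
  have d3: "(y, z) \<in> parcs H \<or> (x, y) \<in> parcs H" if "(x, z) \<in> parcs H"
    using layer_triple_edge[of a b x z y] V ne that off s by (auto simp: insert_commute)
  show ?thesis using H.not_exactly_two_edges[OF offH ne] d1 d2 d3 by blast
qed

text \<open>A non-simplicial \<open>a\<close> would have two nonadjacent neighbours, and the W-shaped path through their layers
  would visit all three vertices.\<close>

lemma simplicial_of_shared_coordinate: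
  assumes V: "a \<in> pverts G" "{x, y, z} \<subseteq> pverts H" and ne: "x \<noteq> y" "y \<noteq> z" "x \<noteq> z"
    and ind: "(x, y) \<notin> parcs H" "(y, z) \<notin> parcs H" "(x, z) \<notin> parcs H"
    and c: "c = a \<or> (a, c) \<in> parcs G"
    and off: "\<not> on_induced_path (G \<box> H) {(a, x), (a, y), (c, z)}"
  shows "simplicial G a"
proof (rule ccontr)
  assume "\<not> simplicial G a"
  then obtain p q where pq: "(a, p) \<in> parcs G" "(a, q) \<in> parcs G" "p \<noteq> q" "(p, q) \<notin> parcs G"
    using V G.adj_verts unfolding simplicial_def is_clique_def by blast
  have qp: "(q, p) \<notin> parcs G" using pq G.adj_sym by blast
  \<comment> \<open>The last layer of the W must be that of \<open>c\<close> or be adjacent to it. If \<open>c \<noteq> a\<close> and neither \<open>p\<close> nor \<open>q\<close>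
    qualifies, then \<open>c\<close> itself is a neighbour of \<open>a\<close> that is not adjacent to \<open>p\<close>.\<close>
  have "\<exists>e d. (a, e) \<in> parcs G \<and> (a, d) \<in> parcs G \<and> e \<noteq> d \<and> (e, d) \<notin> parcs G \<and>
      (c = d \<or> (d, c) \<in> parcs G) \<and> c \<noteq> e"
  proof (cases "c = a")
    case True
    have "a \<noteq> p" using pq(1) G.adj_irrefl by auto
    then show ?thesis using True pq G.adj_sym by (intro exI[of _ p] exI[of _ q]) auto
  next
    case False
    then have ac: "(a, c) \<in> parcs G" using c by blast
    consider "c = p \<or> (p, c) \<in> parcs G \<and> c \<noteq> q" | "c = q \<or> (q, c) \<in> parcs G \<and> c \<noteq> p"
      | "c \<noteq> p" "(p, c) \<notin> parcs G" using pq qp by blast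
    then show ?thesis
    proof cases
      case 1 then show ?thesis using pq qp by (intro exI[of _ q] exI[of _ p]) auto
    next
      case 2 then show ?thesis using pq qp by (intro exI[of _ p] exI[of _ q]) auto
    next
      case 3 then show ?thesis using pq ac by (intro exI[of _ p] exI[of _ c]) auto
    qed
  qed
  then obtain e d where ed: "(a, e) \<in> parcs G" "(a, d) \<in> parcs G" "e \<noteq> d" "(e, d) \<notin> parcs G"
      "c = d \<or> (d, c) \<in> parcs G" "c \<noteq> e" by blast
  have cV: "c \<in> pverts G" using c V G.adj_verts by blast
  have offH: "\<not> on_induced_path H {x, y, z}"
    using on_induced_path_lift_H[of x y z a a c] V cV ne off by blast
  obtain P Q where P: "induced_path H x P y" and Q: "induced_path H y Q z"
    using H.induced_path_exists[OF connected_H] V by (meson insert_subset)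
  have "z \<notin> P" "x \<notin> Q"
    using offH on_induced_pathI[OF P, of "{x, y, z}"] induced_path_ends[OF P]
      on_induced_pathI[OF Q, of "{x, y, z}"] induced_path_ends[OF Q] by auto
  then show False using w_shaped_path[OF ed(1-4) P _ Q _ ind ed(5,6)] off by blast
qed

end

section \<open>Cliques and position sets of maximum size\<close>

text \<open>Turns a dichotomy for triples into one for the whole set: two triples that share a pair must be of the
  same kind.\<close>

lemma homogeneous_triples:
  assumes sym: "\<And>u v. R u v \<Longrightarrow> R v u"
    and triple: "\<And>u v w. \<lbrakk>u \<in> S; v \<in> S; w \<in> S; u \<noteq> v; v \<noteq> w; u \<noteq> w\<rbrakk> \<Longrightarrow>
      R u v \<and> R v w \<and> R u w \<or> \<not> R u v \<and> \<not> R v w \<and> \<not> R u w"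
  shows "(\<forall>u\<in>S. \<forall>v\<in>S. u \<noteq> v \<longrightarrow> R u v) \<or> (\<forall>u\<in>S. \<forall>v\<in>S. u \<noteq> v \<longrightarrow> \<not> R u v)"
proof (rule disjCI)
  assume "\<not> (\<forall>u\<in>S. \<forall>v\<in>S. u \<noteq> v \<longrightarrow> \<not> R u v)"
  then obtain u v where uv: "u \<in> S" "v \<in> S" "u \<noteq> v" "R u v" by blast
  have u: "R u p" if "p \<in> S" "p \<noteq> u" for p
    using triple[of u v p] uv that by blast
  show "\<forall>p\<in>S. \<forall>q\<in>S. p \<noteq> q \<longrightarrow> R p q"
  proof (intro ballI impI)
    fix p q assume "p \<in> S" "q \<in> S" "p \<noteq> q"
    then show "R p q" using u[of p] u[of q] triple[of u p q] uv(1) sym by metis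
  qed
qed

lemma third_element:
  assumes "3 \<le> card M"
  shows "\<exists>w\<in>M. w \<noteq> u \<and> w \<noteq> v"
proof (rule ccontr)
  assume "\<not> ?thesis"
  then have "M \<subseteq> {u, v}" by blast
  then have "card M \<le> card {u, v}" by (rule card_mono[rotated]) simp
  also have "\<dots> \<le> 2" by (simp add: card_insert_if)
  finally show False using assms by simp
qed

context pair_graph
begin

lemma finite_card_sets_of_vertices: "finite (card ` {S. S \<subseteq> pverts G \<and> Q S})"
  using pair_finite_verts by simp

lemma card_le_clique_number:
  assumes "is_clique G S" shows "card S \<le> clique_number G"
proof -
  have "{S. is_clique G S} = {S. S \<subseteq> pverts G \<and> is_clique G S}" by (auto simp: is_clique_def)
  then show ?thesis unfolding clique_number_def
    using assms finite_card_sets_of_vertices[of "is_clique G"] by (intro Max_ge) auto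
qed

lemma clique_number_attained: "\<exists>S. is_clique G S \<and> card S = clique_number G"
proof -
  have "{S. is_clique G S} = {S. S \<subseteq> pverts G \<and> is_clique G S}" by (auto simp: is_clique_def)
  moreover have "{S. is_clique G S} \<noteq> {}" by (auto simp: is_clique_def intro: exI[of _ "{}"])
  ultimately have "clique_number G \<in> card ` {S. is_clique G S}" unfolding clique_number_def
    using finite_card_sets_of_vertices[of "is_clique G"] by (intro Max_in) auto
  then show ?thesis by auto
qed

lemma card_le_mp:
  assumes "monophonic_position_set G S" shows "card S \<le> mp G"
proof -
  have "{S. monophonic_position_set G S} = {S. S \<subseteq> pverts G \<and> monophonic_position_set G S}"
    by (auto simp: monophonic_position_set_def)
  then show ?thesis unfolding mp_def
    using assms finite_card_sets_of_vertices[of "monophonic_position_set G"] by (intro Max_ge) auto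
qed

lemma mp_attained: "\<exists>S. monophonic_position_set G S \<and> card S = mp G"
proof -
  have "{S. monophonic_position_set G S} = {S. S \<subseteq> pverts G \<and> monophonic_position_set G S}"
    by (auto simp: monophonic_position_set_def)
  moreover have "monophonic_position_set G {}" by (simp add: monophonic_position_set_def)
  ultimately have "mp G \<in> card ` {S. monophonic_position_set G S}" unfolding mp_def
    using finite_card_sets_of_vertices[of "monophonic_position_set G"] by (intro Max_in) auto
  then show ?thesis by auto
qed

lemma card_le_mp_i:
  assumes "independent_set G S" and "monophonic_position_set G S" shows "card S \<le> mp_i G"
proof -
  have "{S. independent_set G S \<and> monophonic_position_set G S} =
      {S. S \<subseteq> pverts G \<and> independent_set G S \<and> monophonic_position_set G S}"
    by (auto simp: monophonic_position_set_def)
  then show ?thesis unfolding mp_i_def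
    using assms finite_card_sets_of_vertices[of "\<lambda>S. independent_set G S \<and> monophonic_position_set G S"]
    by (intro Max_ge) auto
qed

text \<open>The outer two of three vertices of an induced path are never adjacent.\<close>

lemma triangle_not_on_induced_path:
  assumes "(x, y) \<in> parcs G" "(y, z) \<in> parcs G" "(x, z) \<in> parcs G"
  shows "\<not> on_induced_path G {x, y, z}"
proof
  have d: "x \<noteq> y" "y \<noteq> z" "x \<noteq> z" using assms adj_irrefl by auto
  assume "on_induced_path G {x, y, z}"
  from on_induced_path_middle[OF this d] obtain a b c
    where abc: "{a, b, c} = {x, y, z}" and ac: "a \<noteq> c" "(a, c) \<notin> parcs G" by blast
  have "a \<in> {x, y, z}" "c \<in> {x, y, z}" using abc by auto
  then show False using assms ac adj_sym by auto
qed

lemma clique_is_monophonic_position_set: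
  assumes "is_clique G S" shows "monophonic_position_set G S"
  using assms triangle_not_on_induced_path
  unfolding monophonic_position_set_iff is_clique_def by blast

lemma neighbour_exists:
  assumes "connected (with_proj G)" "2 \<le> card (pverts G)" "a \<in> pverts G"
  shows "\<exists>b. (a, b) \<in> parcs G"
proof -
  have "\<not> pverts G \<subseteq> {a}" using assms(2) card_mono[of "{a}" "pverts G"] by auto
  then obtain v where v: "v \<in> pverts G" "v \<noteq> a" by blast
  then obtain S where "induced_path G a S v" using induced_path_exists assms by blast
  then show ?thesis using v by (cases rule: induced_path.cases) auto
qed

lemma two_le_clique_number:
  assumes "connected (with_proj G)" "2 \<le> card (pverts G)"
  shows "2 \<le> clique_number G"
proof -
  have "pverts G \<noteq> {}" using assms(2) by auto
  then obtain a where a: "a \<in> pverts G" by blast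
  obtain b where ab: "(a, b) \<in> parcs G" using neighbour_exists[OF assms a] by blast
  have "is_clique G {a, b}" using ab adj_sym adj_verts[OF ab] unfolding is_clique_def by auto
  moreover have "a \<noteq> b" using ab adj_irrefl by auto
  ultimately show ?thesis using card_le_clique_number[of "{a, b}"] by simp
qed

lemma two_le_card_vertices:
  assumes "connected (with_proj G)" "\<nexists>v. simplicial G v"
  shows "2 \<le> card (pverts G)"
proof -
  have "pverts G \<noteq> {}"
    using assms(1) by (auto simp: connected_def strongly_connected_def)
  then obtain v where v: "v \<in> pverts G" by blast
  then obtain p where p: "(v, p) \<in> parcs G"
    using assms(2) unfolding simplicial_def is_clique_def by auto
  have "card {v, p} \<le> card (pverts G)"
    using adj_verts[OF p] pair_finite_verts by (intro card_mono) auto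
  then show ?thesis using p adj_irrefl by (cases "v = p") auto
qed

end

section \<open>Bounds for the product\<close>

context connected_factors
begin

lemma clique_layer:
  assumes "is_clique G S" "h \<in> pverts H"
  shows "is_clique (G \<box> H) (S \<times> {h})"
  using assms unfolding is_clique_def by auto

lemma clique_number_le_mp: "clique_number G \<le> mp (G \<box> H)"
proof -
  obtain S where S: "is_clique G S" "card S = clique_number G" using G.clique_number_attained by blast
  obtain h where "h \<in> pverts H"
    using connected_H by (auto simp: connected_def strongly_connected_def)
  then have "card (S \<times> {h}) \<le> mp (G \<box> H)"
    using S clique_layer product.clique_is_monophonic_position_set product.card_le_mp by blast
  then show ?thesis using S by (simp add: card_cartesian_product)
qed

lemma monophonic_position_set_swap:
  assumes "monophonic_position_set (G \<box> H) M"
  shows "monophonic_position_set (H \<box> G) (prod.swap ` M)"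
proof -
  interpret swap: connected_factors H G by (rule swapped)
  have "\<not> on_induced_path (H \<box> G) {prod.swap u, prod.swap v, prod.swap w}"
    if "u \<in> M" "v \<in> M" "w \<in> M" "u \<noteq> v" "v \<noteq> w" "u \<noteq> w" for u v w
  proof
    assume "on_induced_path (H \<box> G) {prod.swap u, prod.swap v, prod.swap w}"
    from swap.on_induced_path_swap[OF this] have "on_induced_path (G \<box> H) {u, v, w}" by simp
    then show False using assms that unfolding product.monophonic_position_set_iff by blast
  qed
  moreover have "prod.swap ` M \<subseteq> pverts (H \<box> G)"
    using assms unfolding product.monophonic_position_set_iff by auto
  ultimately show ?thesis
    unfolding swap.product.monophonic_position_set_iff ball_simps(9) by metis
qed

text \<open>The projection is injective under these conditions, so no vertices are lost in it.\<close>

lemma card_le_mp_i_of_projection: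
  assumes M: "monophonic_position_set (G \<box> H) M"
    and proj: "\<And>a x b y. \<lbrakk>(a, x) \<in> M; (b, y) \<in> M; (a, x) \<noteq> (b, y)\<rbrakk> \<Longrightarrow> x \<noteq> y \<and> (x, y) \<notin> parcs H"
  shows "card M \<le> mp_i H"
proof -
  have MV: "M \<subseteq> pverts G \<times> pverts H"
    using M unfolding product.monophonic_position_set_iff by simp
  have "inj_on snd M" using proj by (fastforce intro: inj_onI)
  then have "card M = card (snd ` M)" by (simp add: card_image)
  also have "\<dots> \<le> mp_i H"
  proof (rule H.card_le_mp_i)
    show "independent_set H (snd ` M)"
      using MV proj H.adj_irrefl unfolding independent_set_def by fastforce
    have "\<not> on_induced_path H {x, y, z}"
      if "(a, x) \<in> M" "(b, y) \<in> M" "(c, z) \<in> M" "x \<noteq> y" "y \<noteq> z" "x \<noteq> z" for a x b y c z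
    proof
      assume "on_induced_path H {x, y, z}"
      then have "on_induced_path (G \<box> H) {(a, x), (b, y), (c, z)}"
        using that MV by (intro on_induced_path_lift_H) auto
      then show False using M that unfolding product.monophonic_position_set_iff by blast
    qed
    then show "monophonic_position_set H (snd ` M)"
      using MV unfolding H.monophonic_position_set_iff by fastforce
  qed
  finally show ?thesis .
qed

text \<open>If the whole set lies in the layer of \<open>a\<close>, it projects to a clique or to an independent set. Otherwise
  the first coordinates outside the layer are neighbours of \<open>a\<close>, and \<open>a\<close> is simplicial, so that all first
  coordinates together form a clique; then any two second coordinates turn out to be distinct and
  nonadjacent.\<close>

lemma bound_of_shared_coordinate:
  assumes M: "monophonic_position_set (G \<box> H) M" and three: "3 \<le> card M"
    and ax: "(a, x) \<in> M" and ay: "(a, y) \<in> M" and xy: "x \<noteq> y"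
    and two: "2 \<le> card (pverts G)"
  shows "card M \<le> clique_number H \<or> (\<exists>v. simplicial G v) \<and> card M \<le> mp_i H"
proof -
  have MV: "u \<in> pverts G" "v \<in> pverts H" if "(u, v) \<in> M" for u v
    using M that unfolding product.monophonic_position_set_iff by auto
  have off: "\<not> on_induced_path (G \<box> H) {u, v, w}"
    if "u \<in> M" "v \<in> M" "w \<in> M" "u \<noteq> v" "v \<noteq> w" "u \<noteq> w" for u v w
    using M that unfolding product.monophonic_position_set_iff by blast
  have aV: "a \<in> pverts G" using MV ax by blast
  show ?thesis
  proof (cases "\<forall>(c, z)\<in>M. c = a")
    case True
    define S where "S = snd ` M"
    have M_eq: "M = {a} \<times> S" using True by (force simp: S_def)
    have cardM: "card M = card S" unfolding M_eq by (simp add: card_cartesian_product)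
    obtain b where ab: "(a, b) \<in> parcs G" using G.neighbour_exists[OF connected_G two aV] by blast
    have SV: "S \<subseteq> pverts H" using MV M_eq by auto
    have "(\<forall>u\<in>S. \<forall>v\<in>S. u \<noteq> v \<longrightarrow> (u, v) \<in> parcs H) \<or> (\<forall>u\<in>S. \<forall>v\<in>S. u \<noteq> v \<longrightarrow> (u, v) \<notin> parcs H)"
    proof (rule homogeneous_triples)
      show "(v, u) \<in> parcs H" if "(u, v) \<in> parcs H" for u v using that by (rule H.adj_sym)
      fix u v w assume "u \<in> S" "v \<in> S" "w \<in> S" and ne: "u \<noteq> v" "v \<noteq> w" "u \<noteq> w"
      then show "(u, v) \<in> parcs H \<and> (v, w) \<in> parcs H \<and> (u, w) \<in> parcs H \<or>
          (u, v) \<notin> parcs H \<and> (v, w) \<notin> parcs H \<and> (u, w) \<notin> parcs H"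
        using layer_triple[OF ab _ ne] SV off[of "(a, u)" "(a, v)" "(a, w)"] M_eq by auto
    qed
    then show ?thesis
    proof
      assume "\<forall>u\<in>S. \<forall>v\<in>S. u \<noteq> v \<longrightarrow> (u, v) \<in> parcs H"
      then have "is_clique H S" using SV unfolding is_clique_def by blast
      then show ?thesis using H.card_le_clique_number cardM by simp
    next
      assume ind: "\<forall>u\<in>S. \<forall>v\<in>S. u \<noteq> v \<longrightarrow> (u, v) \<notin> parcs H"
      obtain z where z: "z \<in> S" "z \<noteq> x" "z \<noteq> y"
        using third_element[of S x y] three cardM by auto
      have xS: "x \<in> S" "y \<in> S" using ax ay M_eq by auto
      have "simplicial G a"
        using simplicial_of_shared_coordinate[of a x y z a] aV xS z SV xy ind
          off[of "(a, x)" "(a, y)" "(a, z)"] M_eq by auto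
      moreover have "card M \<le> mp_i H"
        using ind M_eq by (intro card_le_mp_i_of_projection[OF M]) auto
      ultimately show ?thesis by blast
    qed
  next
    case False
    then obtain c0 z0 where c0: "(c0, z0) \<in> M" "c0 \<noteq> a" by auto
    have shared: "(a, c) \<in> parcs G" "u \<noteq> z" "v \<noteq> z"
        "(u, v) \<notin> parcs H" "(v, z) \<notin> parcs H" "(u, z) \<notin> parcs H"
      if "(a, u) \<in> M" "(a, v) \<in> M" "u \<noteq> v" "(c, z) \<in> M" "c \<noteq> a" for u v c z
    proof -
      have "\<not> on_induced_path (G \<box> H) {(a, u), (a, v), (c, z)}"
        using that by (intro off) auto
      then show "(a, c) \<in> parcs G" "u \<noteq> z" "v \<noteq> z"
          "(u, v) \<notin> parcs H" "(v, z) \<notin> parcs H" "(u, z) \<notin> parcs H"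
        using shared_coordinate_triple[OF aV MV(1)[OF that(4)] MV(2)[OF that(1)]
          MV(2)[OF that(2)] MV(2)[OF that(4)]] that by auto
    qed
    have simp_a: "simplicial G a"
    proof (rule simplicial_of_shared_coordinate[of a x y z0 c0])
      show "\<not> on_induced_path (G \<box> H) {(a, x), (a, y), (c0, z0)}"
        using ax ay c0 xy by (intro off) auto
    qed (use shared[OF ax ay xy c0] xy MV[OF ax] MV[OF ay] MV[OF c0(1)] in auto)
    \<comment> \<open>As the layer of \<open>a\<close> contains two vertices of the set, each of its vertices has a partner there, with
      which \<open>shared\<close> applies.\<close>
    have other: "(a, c) \<in> parcs G \<and> (\<forall>u. (a, u) \<in> M \<longrightarrow> u \<noteq> z \<and> (u, z) \<notin> parcs H)"
      if cz: "(c, z) \<in> M" "c \<noteq> a" for c z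
    proof (intro conjI allI impI)
      show "(a, c) \<in> parcs G" using shared(1)[OF ax ay xy cz] .
      fix u assume u: "(a, u) \<in> M"
      obtain v where v: "(a, v) \<in> M" "u \<noteq> v" using ax ay xy by blast
      show "u \<noteq> z" "(u, z) \<notin> parcs H" using shared(2,6)[OF u v cz] by auto
    qed
    have "card M \<le> mp_i H"
    proof (rule card_le_mp_i_of_projection[OF M])
      fix c z d w assume cz: "(c, z) \<in> M" and dw: "(d, w) \<in> M" and ne: "(c, z) \<noteq> (d, w)"
      consider "c = a" "d = a" | "c = a" "d \<noteq> a" | "c \<noteq> a" "d = a"
        | "c \<noteq> a" "d = c" | "c \<noteq> a" "d \<noteq> a" "c \<noteq> d" by blast
      then show "z \<noteq> w \<and> (z, w) \<notin> parcs H"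
      proof cases
        case 1 then show ?thesis using shared(4)[of z w] c0 cz dw ne by auto
      next
        case 2 then show ?thesis using other[OF dw] cz by auto
      next
        case 3 then show ?thesis using other[OF cz] dw H.adj_sym by blast
      next
        case 4
        then have "\<not> on_induced_path (G \<box> H) {(c, z), (c, w), (a, x)}"
          using cz dw ne ax by (intro off) auto
        then show ?thesis
          using shared_coordinate_triple(4)[of c a z w x] 4 ne MV[OF cz] MV[OF dw] MV[OF ax] by auto
      next
        case 5
        have ac: "(a, c) \<in> parcs G" "(a, d) \<in> parcs G"
          using other[OF cz 5(1)] other[OF dw 5(2)] by blast+
        then have cd: "(c, d) \<in> parcs G"
          using simp_a 5(3) unfolding simplicial_def is_clique_def by blast
        have x: "x \<noteq> z" "x \<noteq> w" using other[OF cz 5(1)] other[OF dw 5(2)] ax by blast+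
        \<comment> \<open>With \<open>z = w\<close> the two vertices would share their second coordinate. Then the exchanged form of
          the same fact says that \<open>c\<close> and \<open>d\<close> are not adjacent.\<close>
        have "z \<noteq> w"
        proof
          assume "z = w"
          interpret swap: connected_factors H G by (rule swapped)
          have "\<not> on_induced_path (G \<box> H) {(c, z), (d, z), (a, x)}"
            using cz dw ax 5 \<open>z = w\<close> by (intro off) auto
          then have "\<not> on_induced_path (H \<box> G) {(z, c), (z, d), (x, a)}"
            using swap.on_induced_path_swap[of "{(z, c), (z, d), (x, a)}"] by auto
          then show False
            using swap.shared_coordinate_triple(4)[of z x c d a] cd 5 x MV[OF cz] MV[OF dw] MV[OF ax]
            by auto
        qed
        moreover have "\<not> on_induced_path (G \<box> H) {(a, x), (c, z), (d, w)}"
          using cz dw ax 5 by (intro off) auto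
        then have "(z, w) \<notin> parcs H"
          using clique_triple(2)[of x z w a c d] ac cd x calculation MV[OF cz] MV[OF dw] MV[OF ax] by auto
        ultimately show ?thesis by blast
      qed
    qed
    then show ?thesis using simp_a by blast
  qed
qed

text \<open>Every triple projects to a triangle of \<open>G\<close>, or else to an independent set of \<open>G\<close> and a triangle of \<open>H\<close>;
  overlapping triples agree on which of the two holds.\<close>

lemma bound_of_general_position:
  assumes M: "monophonic_position_set (G \<box> H) M" and three: "3 \<le> card M"
    and inj: "inj_on fst M" "inj_on snd M"
  shows "card M \<le> clique_number G \<or> card M \<le> clique_number H"
proof -
  have MV: "M \<subseteq> pverts G \<times> pverts H"
    using M unfolding product.monophonic_position_set_iff by auto
  define R where "R u v \<longleftrightarrow> (fst u, fst v) \<in> parcs G" for u v :: "'a \<times> 'b"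
  have triple: "R u v \<and> R v w \<and> R u w \<or> \<not> R u v \<and> \<not> R v w \<and> \<not> R u w \<and> (snd u, snd v) \<in> parcs H"
    if uvw: "u \<in> M" "v \<in> M" "w \<in> M" "u \<noteq> v" "v \<noteq> w" "u \<noteq> w" for u v w
  proof -
    have "\<not> on_induced_path (G \<box> H) {u, v, w}"
      using M uvw unfolding product.monophonic_position_set_iff by blast
    then have off: "\<not> on_induced_path (G \<box> H) {(fst u, snd u), (fst v, snd v), (fst w, snd w)}" by simp
    have "fst u \<noteq> fst v" "fst v \<noteq> fst w" "fst u \<noteq> fst w" "snd u \<noteq> snd v" "snd v \<noteq> snd w" "snd u \<noteq> snd w"
      using inj uvw by (auto dest: inj_onD)
    moreover have "{fst u, fst v, fst w} \<subseteq> pverts G" "{snd u, snd v, snd w} \<subseteq> pverts H"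
      using MV uvw by auto
    ultimately show ?thesis
      using general_position_triple[OF _ _ _ _ _ _ _ _ off] unfolding R_def by blast
  qed
  have "(\<forall>u\<in>M. \<forall>v\<in>M. u \<noteq> v \<longrightarrow> R u v) \<or> (\<forall>u\<in>M. \<forall>v\<in>M. u \<noteq> v \<longrightarrow> \<not> R u v)"
  proof (rule homogeneous_triples)
    show "R v u" if "R u v" for u v using that G.adj_sym by (simp add: R_def)
  qed (use triple in blast)
  then show ?thesis
  proof
    assume "\<forall>u\<in>M. \<forall>v\<in>M. u \<noteq> v \<longrightarrow> R u v"
    then have "is_clique G (fst ` M)" using MV unfolding is_clique_def R_def by fastforce
    then show ?thesis using G.card_le_clique_number card_image[OF inj(1)] by metis
  next
    assume nR: "\<forall>u\<in>M. \<forall>v\<in>M. u \<noteq> v \<longrightarrow> \<not> R u v"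
    have "(snd u, snd v) \<in> parcs H" if "u \<in> M" "v \<in> M" "u \<noteq> v" for u v
    proof -
      obtain w where "w \<in> M" "w \<noteq> u" "w \<noteq> v" using third_element[OF three] by blast
      then show ?thesis using triple[of u v w] that nR by blast
    qed
    then have "is_clique H (snd ` M)" using MV unfolding is_clique_def by fastforce
    then show ?thesis using H.card_le_clique_number card_image[OF inj(2)] by metis
  qed
qed

text \<open>Sets with at most two vertices are no larger than an edge of \<open>G\<close>. This leaves the sets with two
  vertices in a common layer and those without.\<close>

lemma mp_upper_bound:
  assumes "2 \<le> card (pverts G)" "2 \<le> card (pverts H)"
  shows "mp (G \<box> H) \<le> Max {clique_number G, clique_number H, \<sigma> G * mp_i H, \<sigma> H * mp_i G}"
proof -
  interpret swap: connected_factors H G by (rule swapped)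
  obtain M where M: "monophonic_position_set (G \<box> H) M" "card M = mp (G \<box> H)"
    using product.mp_attained by blast
  have "card M \<le> clique_number G \<or> card M \<le> clique_number H \<or> card M \<le> \<sigma> G * mp_i H \<or>
      card M \<le> \<sigma> H * mp_i G"
  proof (cases "3 \<le> card M")
    case False
    then show ?thesis using G.two_le_clique_number[OF connected_G assms(1)] by simp
  next
    case three: True
    show ?thesis
    proof (cases "inj_on fst M \<and> inj_on snd M")
      case True then show ?thesis using bound_of_general_position[OF M(1) three] by blast
    next
      case False
      then consider a x y where "(a, x) \<in> M" "(a, y) \<in> M" "x \<noteq> y"
        | a b x where "(a, x) \<in> M" "(b, x) \<in> M" "a \<noteq> b"
        by (force simp: inj_on_def)
      then show ?thesis
      proof cases
        case 1
        then show ?thesis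
          using bound_of_shared_coordinate[OF M(1) three 1 assms(1)]
          by (auto simp: simplicial_indicator_def)
      next
        case 2
        have card: "card (prod.swap ` M) = card M" by (simp add: card_image)
        have "(x, a) \<in> prod.swap ` M" "(x, b) \<in> prod.swap ` M" using 2 by force+
        then have "card M \<le> clique_number G \<or> (\<exists>v. simplicial H v) \<and> card M \<le> mp_i G"
          using swap.bound_of_shared_coordinate[OF monophonic_position_set_swap[OF M(1)]]
            2(3) three assms(2) card by metis
        then show ?thesis by (auto simp: simplicial_indicator_def)
      qed
    qed
  qed
  then show ?thesis using M(2) by (simp add: le_max_iff_disj)
qed

end

theorem theorem3p16:
  fixes G :: "'a pair_pre_digraph" and H :: "'b pair_pre_digraph"
  assumes "pair_graph G" and "pair_graph H"
    and "connected (with_proj G)" and "connected (with_proj H)"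
  shows "Max {clique_number G, clique_number H} \<le> mp (G \<box> H)
    \<and> (2 \<le> card (pverts G) \<and> 2 \<le> card (pverts H) \<longrightarrow>
        mp (G \<box> H) \<le> Max {clique_number G, clique_number H, \<sigma> G * mp_i H, \<sigma> H * mp_i G})
    \<and> ((\<nexists>v. simplicial G v) \<and> (\<nexists>v. simplicial H v) \<longrightarrow>
        mp (G \<box> H) = Max {clique_number G, clique_number H})"
proof -
  interpret GH: connected_factors G H
    using assms by (simp add: connected_factors_def connected_factors_axioms_def)
  interpret HG: connected_factors H G by (rule GH.swapped)
  have "mp (H \<box> G) \<le> mp (G \<box> H)"
  proof -
    obtain M where M: "monophonic_position_set (H \<box> G) M" "card M = mp (H \<box> G)"
      using HG.product.mp_attained by blast
    have "card (prod.swap ` M) = card M" by (simp add: card_image)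
    then show ?thesis
      using GH.product.card_le_mp[OF HG.monophonic_position_set_swap[OF M(1)]] M(2) by simp
  qed
  then have lower: "Max {clique_number G, clique_number H} \<le> mp (G \<box> H)"
    using GH.clique_number_le_mp HG.clique_number_le_mp by simp
  moreover have "mp (G \<box> H) = Max {clique_number G, clique_number H}"
    if "\<nexists>v. simplicial G v" "\<nexists>v. simplicial H v"
  proof (rule antisym[OF _ lower])
    have "mp (G \<box> H) \<le> Max {clique_number G, clique_number H, \<sigma> G * mp_i H, \<sigma> H * mp_i G}"
      using that assms GH.G.two_le_card_vertices GH.H.two_le_card_vertices by (intro GH.mp_upper_bound)
    then show "mp (G \<box> H) \<le> Max {clique_number G, clique_number H}"
      using that by (simp add: simplicial_indicator_def)
  qed
  ultimately show ?thesis using GH.mp_upper_bound by blast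
qed

end
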